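(* Let $M$ be a twice continuously differentiable Orlicz function satisfying $\int y\,dM'(y)<\infty$ and $M'(0)=0$. Let $Q(\cdot)=\int y\,\delta_{1/y}(\cdot)\,dM'(y)$. Then, for any random variable $X$ distributed according to $Q(\cdot)/Q([0,\infty))=\int y\,\delta_{1/y}(\cdot)\,dM'(y)/Q([0,\infty))$, and for all $x>0$, $$\bar F(x)=\bar F_X(x)=\int_0^{1/x} y\,M''(y)\,dy=\frac{1}{x}M'\left(\frac{1}{x}\right)-M\left(\frac{1}{x}\right).$$ In particular, for all $x>0$, $$\bar F(x)=\int_x^\infty \frac{1}{y^3}M''\left(\frac{1}{y}\right)dy.$$
   Context: A function $M:[0,\infty)\to[0,\infty)$ is called an Orlicz function if it is convex, $M(0)=0$, and $M(t)>0$ for all $t>0$. $M'$ is the (right-hand) derivative of $M$, and integrals $\int\cdots\,dM'(y)$ are Lebesgue-Stieltjes integrals over $[0,\infty)$ with respect to the non-decreasing function $M'$. $\delta_a$ is the Dirac measure at $a$. $F_X$ denotes the distribution function of $X$, $\bar F_X=1-F_X$ its tail distribution function, and $\bar F$ is shorthand for $\bar F_X$.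
   Formalization: Both integral formulas for the tail are divided by Q([0,∞)), a factor the printed identities omit; without it they fail, e.g. for M(t)=2(e^{-t}-1+t), where Q([0,∞))=2. For Q([0,∞))=1 they are as printed. *)

theory Defs
  imports "HOL-Probability.Probability"
begin

text \<open>Functions on \<open>[0,\<infinity>)\<close> are represented by total functions on the reals of which only
  the values on \<open>{0..}\<close> are used.\<close>

definition orlicz_function :: "(real \<Rightarrow> real) \<Rightarrow> bool" where
  "orlicz_function M \<longleftrightarrow> convex_on {0..} M \<and> M 0 = 0 \<and> (\<forall>t\<ge>0. M t \<ge> 0) \<and> (\<forall>t>0. M t > 0)"

definition right_deriv :: "(real \<Rightarrow> real) \<Rightarrow> real \<Rightarrow> real" where
  "right_deriv M t = vector_derivative M (at_right t)"

text \<open>The derivative within \<open>{0..}\<close> is the ordinary derivative at \<open>t > 0\<close> and the one-sided one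
  at \<open>t = 0\<close>.\<close>

definition second_deriv :: "(real \<Rightarrow> real) \<Rightarrow> real \<Rightarrow> real" where
  "second_deriv M t = vector_derivative (right_deriv M) (at t within {0..})"

definition twice_continuously_differentiable :: "(real \<Rightarrow> real) \<Rightarrow> bool" where
  "twice_continuously_differentiable M \<longleftrightarrow>
     M differentiable_on {0..} \<and> right_deriv M differentiable_on {0..} \<and>
     continuous_on {0..} (second_deriv M)"

text \<open>The Lebesgue-Stieltjes measure of a non-decreasing right-continuous function on \<open>[0,\<infinity>)\<close>.
  Extending \<open>G\<close> to the negative reals by the constant \<open>G 0\<close> puts no mass on \<open>{..0}\<close>.\<close>

definition stieltjes :: "(real \<Rightarrow> real) \<Rightarrow> real measure" where
  "stieltjes G = interval_measure (\<lambda>t. G (max 0 t))"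

text \<open>\<open>return borel a\<close> is the Dirac measure at \<open>a\<close>. The value \<open>1 / 0 = 0\<close> is harmless, since the
  weight \<open>y\<close> vanishes at \<open>y = 0\<close>.\<close>

definition Q_measure :: "(real \<Rightarrow> real) \<Rightarrow> real measure" where
  "Q_measure M = measure_of UNIV (sets borel)
     (\<lambda>A. \<integral>\<^sup>+y\<in>{0..}. ennreal y * emeasure (return borel (1 / y)) A \<partial>stieltjes (right_deriv M))"

definition tail_distribution :: "'a measure \<Rightarrow> ('a \<Rightarrow> real) \<Rightarrow> real \<Rightarrow> real" where
  "tail_distribution P X x = 1 - cdf (distr P borel X) x"

end

(* By the fundamental theorem of calculus the Stieltjes measure of M' has density M'' on [0,\<infinity>).
   Since 1/y > x iff y < 1/x (for y > 0), the tail Q((x,\<infinity>)) is the integral of y M''(y) over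
   [0,1/x], and y M''(y) is the derivative of y M'(y) - M(y). *)

theory Submission
  imports Defs
begin

section \<open>Calculus with one-sided derivatives\<close>

text \<open>Continuity on a compact interval gives integrability, and nonnegativity turns the
  Lebesgue integral into the extended nonnegative one. Derivatives are taken within the interval
  because at 0 only a one-sided derivative of \<open>M\<close> or of its derivative is
  meaningful.\<close>

lemma nn_integral_FTC_within:
  fixes f F :: "real \<Rightarrow> real"
  assumes "a \<le> b" and cont: "continuous_on {a..b} f"
    and nonneg: "\<And>x. x \<in> {a..b} \<Longrightarrow> 0 \<le> f x"
    and deriv: "\<And>x. x \<in> {a..b} \<Longrightarrow> (F has_vector_derivative f x) (at x within {a..b})"
  shows "(\<integral>\<^sup>+x\<in>{a..b}. ennreal (f x) \<partial>lborel) = ennreal (F b - F a)"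
proof -
  have "(\<integral>\<^sup>+x\<in>{a..b}. ennreal (f x) \<partial>lborel) = (\<integral>\<^sup>+x. ennreal (indicator {a..b} x *\<^sub>R f x) \<partial>lborel)"
    by (intro nn_integral_cong) (auto split: split_indicator)
  also have "\<dots> = ennreal (LINT x|lborel. indicator {a..b} x *\<^sub>R f x)"
    using borel_integrable_atLeastAtMost'[OF cont]
    by (intro nn_integral_eq_integral)
       (auto simp: set_integrable_def nonneg split: split_indicator)
  also have "(LINT x|lborel. indicator {a..b} x *\<^sub>R f x) = F b - F a"
    using integral_FTC_atLeastAtMost[of a b F f] assms by auto
  finally show ?thesis .
qed

text \<open>Difference quotients of a nondecreasing function are nonnegative on both sides of
  \<open>x\<close>, and a limit along a nontrivial filter preserves this.\<close>

lemma has_vector_derivative_nonneg_of_mono_on: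
  fixes f :: "real \<Rightarrow> real"
  assumes mono: "mono_on S f" and deriv: "(f has_vector_derivative D) (at x within S)"
    and "x \<in> S" and "at x within S \<noteq> bot"
  shows "0 \<le> D"
proof -
  have "((\<lambda>y. (f y - f x) / (y - x)) \<longlongrightarrow> D) (at x within S)"
    using deriv by (simp add: has_real_derivative_iff_has_vector_derivative[symmetric] has_field_derivative_iff)
  moreover have "\<forall>\<^sub>F y in at x within S. 0 \<le> (f y - f x) / (y - x)"
    unfolding eventually_at_topological
  proof (intro exI[of _ UNIV] conjI ballI impI)
    fix y assume "y \<noteq> x" "y \<in> S"
    then show "0 \<le> (f y - f x) / (y - x)"
      using monotone_onD[OF mono, of x y] monotone_onD[OF mono, of y x] \<open>x \<in> S\<close>
      by (cases "x \<le> y") (auto simp: zero_le_divide_iff)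
  qed auto
  ultimately show ?thesis
    using assms(4) by (intro tendsto_lowerbound) auto
qed

lemma at_within_atLeast_neq_bot:
  fixes t :: real
  assumes "0 \<le> t"
  shows "at t within {0..} \<noteq> bot"
proof -
  have "at_right t \<le> at t within {0..}"
    using assms by (intro at_le) auto
  then show ?thesis
    using trivial_limit_at_right_real[of t] by (auto simp: bot_unique)
qed

text \<open>\<open>right_deriv\<close> is chosen along \<open>at_right t\<close>. Since
  \<open>{t<..}\<close> lies in \<open>{0..}\<close>, a derivative within the half-line is also one
  along \<open>at_right t\<close>, where derivatives are unique. This covers \<open>t = 0\<close> as
  well.\<close>

lemma right_deriv_eqI:
  assumes "0 \<le> t" and "(M has_vector_derivative D) (at t within {0..})"
  shows "right_deriv M t = D"
  unfolding right_deriv_def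
proof (rule vector_derivative_within)
  show "(M has_vector_derivative D) (at_right t)"
    using assms by (auto intro: has_vector_derivative_within_subset)
qed simp

section \<open>First and second derivatives on the half-line\<close>

context
  fixes M :: "real \<Rightarrow> real"
  assumes C2: "twice_continuously_differentiable M"
begin

lemma has_right_deriv:
  assumes "0 \<le> t"
  shows "(M has_vector_derivative right_deriv M t) (at t within {0..})"
proof -
  have "(M has_vector_derivative vector_derivative M (at t within {0..})) (at t within {0..})"
    using C2 assms unfolding twice_continuously_differentiable_def differentiable_on_def
    by (auto simp: vector_derivative_works[symmetric])
  then show ?thesis
    using right_deriv_eqI[OF assms] by metis
qed

lemma has_second_deriv:
  assumes "0 \<le> t"
  shows "(right_deriv M has_vector_derivative second_deriv M t) (at t within {0..})"
  using C2 assms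
  unfolding twice_continuously_differentiable_def differentiable_on_def second_deriv_def
  by (auto simp: vector_derivative_works[symmetric])

lemma has_right_deriv_at:
  assumes "0 < t"
  shows "(M has_real_derivative right_deriv M t) (at t)"
  using has_right_deriv[of t] assms at_within_interior[of t "{0..}"]
  by (simp add: has_real_derivative_iff_has_vector_derivative)

lemma has_second_deriv_at:
  assumes "0 < t"
  shows "(right_deriv M has_real_derivative second_deriv M t) (at t)"
  using has_second_deriv[of t] assms at_within_interior[of t "{0..}"]
  by (simp add: has_real_derivative_iff_has_vector_derivative)

lemma continuous_on_second_deriv: "continuous_on {0..} (second_deriv M)"
  using C2 by (simp add: twice_continuously_differentiable_def)

lemma isCont_second_deriv: "0 < t \<Longrightarrow> isCont (second_deriv M) t"
  using continuous_on_interior[OF continuous_on_second_deriv, of t] by simp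

text \<open>In the product rule the two first-derivative terms cancel. For convex \<open>M\<close>,
  the function is the convex conjugate of \<open>M\<close> evaluated at
  \<open>right_deriv M t\<close>, hence the name.\<close>

lemma has_vector_derivative_legendre:
  assumes "0 \<le> t"
  shows "((\<lambda>t. t * right_deriv M t - M t) has_vector_derivative t * second_deriv M t) (at t within {0..})"
  using has_right_deriv[OF assms] has_second_deriv[OF assms]
  by (auto intro!: derivative_eq_intros simp: has_real_derivative_iff_has_vector_derivative[symmetric])

end

section \<open>Monotonicity of the first derivative\<close>

text \<open>For two positive points, adding the tangent inequalities of the convex function at each
  of them gives monotonicity. The tangent inequality is used only at interior points of
  \<open>{0..}\<close>, so 0 is treated apart: the tangent at \<open>b\<close>, evaluated at 0,
  gives 0 < M(b) \<le> b M'(b), while M'(0) = 0.\<close>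

lemma right_deriv_mono_on:
  assumes "orlicz_function M" and "twice_continuously_differentiable M" and "right_deriv M 0 = 0"
  shows "mono_on {0..} (right_deriv M)"
proof (rule mono_onI)
  fix a b :: real
  assume ab: "a \<in> {0..}" "b \<in> {0..}" "a \<le> b"
  have tangent: "M y - M c \<ge> right_deriv M c * (y - c)" if "0 < c" "0 \<le> y" for c y
  proof (rule convex_on_imp_above_tangent)
    show "convex_on {0..} M"
      using assms by (simp add: orlicz_function_def)
    show "(M has_real_derivative right_deriv M c) (at c within {0..})"
      using has_right_deriv_at[OF assms(2) that(1)] by (rule has_field_derivative_at_within)
  qed (use that in auto)
  show "right_deriv M a \<le> right_deriv M b"
  proof (cases "a = 0")
    case True
    have "0 \<le> right_deriv M b" if "0 < b"
    proof -
      have "0 < M b" "M 0 = 0"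
        using assms(1) that by (auto simp: orlicz_function_def)
      then have "0 < right_deriv M b * b"
        using tangent[of b 0] that by simp
      then show ?thesis
        using that by (simp add: zero_less_mult_iff)
    qed
    then show ?thesis
      using True assms(3) ab by (cases "b = 0") auto
  next
    case False
    then have "0 < a" "0 < b" using ab by auto
    then have "(right_deriv M b - right_deriv M a) * (b - a) \<ge> 0"
      using tangent[of a b] tangent[of b a] by (simp add: algebra_simps)
    then show ?thesis
      using ab by (cases "a = b") (auto simp: zero_le_mult_iff)
  qed
qed

lemma second_deriv_nonneg:
  assumes "orlicz_function M" and "twice_continuously_differentiable M" and "right_deriv M 0 = 0"
    and "0 \<le> t"
  shows "0 \<le> second_deriv M t"
  using has_vector_derivative_nonneg_of_mono_on[OF right_deriv_mono_on[OF assms(1-3)]]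
    has_second_deriv[OF assms(2)] at_within_atLeast_neq_bot assms(4) by auto

section \<open>The Stieltjes measure as a density\<close>

text \<open>By the fundamental theorem both measures give a half-open interval the increment of
  \<open>G\<close> clamped at 0. Such intervals form an intersection-stable generator, and countably
  many of finite measure cover the line, so the measures coincide. The indicator in the density
  discards the arbitrary values of \<open>g\<close> on the negative reals.\<close>

lemma stieltjes_eq_density:
  fixes G g :: "real \<Rightarrow> real"
  assumes mono: "mono_on {0..} G"
    and deriv: "\<And>t. 0 \<le> t \<Longrightarrow> (G has_vector_derivative g t) (at t within {0..})"
    and cont: "continuous_on {0..} g"
  shows "stieltjes G = density lborel (\<lambda>y. ennreal (indicator {0..} y * g y))"
proof -
  have nonneg: "0 \<le> g t" if "0 \<le> t" for t
    using has_vector_derivative_nonneg_of_mono_on[OF mono deriv] that at_within_atLeast_neq_bot by auto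
  have contG: "continuous_on {0..} G"
    using deriv by (auto simp: continuous_on_eq_continuous_within intro: has_vector_derivative_continuous)
  define F where "F t = G (max 0 t)" for t
  have monoF: "F x \<le> F y" if "x \<le> y" for x y
    unfolding F_def using that by (intro monotone_onD[OF mono]) auto
  have "continuous_on UNIV F"
    unfolding F_def by (rule continuous_on_compose2[OF contG]) (auto intro!: continuous_intros)
  then have contF: "continuous (at_right a) F" for a
    by (auto simp: continuous_on_eq_continuous_at intro: continuous_at_imp_continuous_within)
  have [measurable]: "(\<lambda>y. indicator {0..} y * g y) \<in> borel_measurable borel"
    using borel_measurable_continuous_on_indicator[OF _ cont] by (simp add: real_scaleR_def)
  let ?D = "density lborel (\<lambda>y. ennreal (indicator {0..} y * g y))"
  have Ioc: "emeasure ?D {a<..b} = ennreal (F b - F a)" if "a \<le> b" for a b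
  proof -
    let ?a = "max 0 a" and ?b = "max 0 b"
    have "emeasure ?D {a<..b} = (\<integral>\<^sup>+y\<in>{a<..b}. ennreal (indicator {0..} y * g y) \<partial>lborel)"
      by (rule emeasure_density) auto
    also have "\<dots> = (\<integral>\<^sup>+y\<in>{?a..?b}. ennreal (g y) \<partial>lborel)"
    proof (rule nn_integral_cong_AE)
      \<comment> \<open>Clamping the endpoints and closing the interval changes it by at most one
        point: \<open>a\<close> if \<open>0 \<le> a \<le> b\<close>, and 0 if
        \<open>b < 0\<close>.\<close>
      show "AE y in lborel. ennreal (indicator {0..} y * g y) * indicator {a<..b} y =
        ennreal (g y) * indicator {?a..?b} y"
        using AE_lborel_singleton[of 0] AE_lborel_singleton[of a]
        by eventually_elim (auto split: split_indicator)
    qed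
    also have "\<dots> = ennreal (G ?b - G ?a)"
    proof (rule nn_integral_FTC_within)
      show "continuous_on {?a..?b} g"
        by (rule continuous_on_subset[OF cont]) auto
      show "(G has_vector_derivative g x) (at x within {?a..?b})" if "x \<in> {?a..?b}" for x
        using that by (auto intro!: has_vector_derivative_within_subset[OF deriv])
    qed (use that nonneg in auto)
    finally show ?thesis by (simp add: F_def)
  qed
  have "interval_measure F = ?D"
  proof (rule measure_eqI_generator_eq)
    let ?E = "range (\<lambda>(a, b). {a<..b::real})"
    show "Int_stable ?E"
      by (auto simp: Int_stable_def)
    show "sets (interval_measure F) = sigma_sets UNIV ?E" "sets ?D = sigma_sets UNIV ?E"
      by (simp_all add: borel_sigma_sets_Ioc)
    show "emeasure (interval_measure F) A = emeasure ?D A" if A: "A \<in> ?E" for A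
    proof -
      obtain a b where "A = {a<..b}" using A by auto
      then show ?thesis
        by (cases "a \<le> b") (simp_all add: Ioc emeasure_interval_measure_Ioc monoF contF)
    qed
    show "range (\<lambda>n::nat. {- real n<..real n}) \<subseteq> ?E" by auto
    show "(\<Union>n::nat. {- real n<..real n}) = UNIV"
    proof -
      have "\<exists>n. - real n < x \<and> x \<le> real n" for x :: real
      proof -
        obtain n where "\<bar>x\<bar> < real n"
          using reals_Archimedean2 by blast
        then show ?thesis
          by (intro exI[of _ n]) auto
      qed
      then show ?thesis by auto
    qed
    show "emeasure (interval_measure F) {- real n<..real n} \<noteq> \<infinity>" for n
      by (simp add: emeasure_interval_measure_Ioc monoF contF)
  qed auto
  then show ?thesis
    unfolding stieltjes_def F_def .
qed

section \<open>The measure Q and its tail\<close>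

text \<open>\<open>measure_of\<close> returns the given set function only if that function is a
  measure. Countable additivity comes for free by recognising it as the pushforward, under the map
  from y to 1/y, of the Stieltjes measure weighted by y.\<close>

lemma emeasure_Q_measure:
  assumes [measurable]: "A \<in> sets borel"
  shows "emeasure (Q_measure M) A =
    (\<integral>\<^sup>+y\<in>{0..}. ennreal y * indicator A (1 / y) \<partial>stieltjes (right_deriv M))"
proof -
  let ?S = "stieltjes (right_deriv M)"
  let ?D = "distr (density ?S (\<lambda>y. ennreal y * indicator {0..} y)) borel (\<lambda>y. 1 / y)"
  have [measurable_cong, simp]: "sets ?S = sets borel"
    by (simp add: stieltjes_def)
  then have [simp]: "space ?S = UNIV"
    by (metis sets_eq_imp_space_eq space_borel)
  have D: "emeasure ?D B = (\<integral>\<^sup>+y\<in>{0..}. ennreal y * indicator B (1 / y) \<partial>?S)"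
    if [measurable]: "B \<in> sets borel" for B
  proof -
    have inv: "(\<lambda>y::real. 1 / y) -` B \<in> sets borel"
      using measurable_sets_borel[of "\<lambda>y::real. 1 / y" borel B] that by simp
    have "emeasure ?D B =
      emeasure (density ?S (\<lambda>y. ennreal y * indicator {0..} y)) ((\<lambda>y. 1 / y) -` B)"
      by (subst emeasure_distr) simp_all
    also have "\<dots> = (\<integral>\<^sup>+y\<in>(\<lambda>y. 1 / y) -` B. ennreal y * indicator {0..} y \<partial>?S)"
      using inv by (intro emeasure_density) simp_all
    also have "\<dots> = (\<integral>\<^sup>+y\<in>{0..}. ennreal y * indicator B (1 / y) \<partial>?S)"
      by (intro nn_integral_cong) (auto split: split_indicator)
    finally show ?thesis .
  qed
  \<comment> \<open>\<open>measure_of\<close> depends only on the values on Borel sets, where both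
    set functions agree.\<close>
  have "Q_measure M = measure_of UNIV (sets borel) (emeasure ?D)"
    unfolding Q_measure_def
    by (rule measure_of_eq) (auto simp: D sets.space_closed[of borel, simplified] sets.sigma_sets_eq[of borel, simplified])
  also have "\<dots> = ?D"
    using measure_of_of_measure[of ?D] by simp
  finally show ?thesis
    using D assms by simp
qed

lemma sets_Q_measure [simp, measurable_cong]: "sets (Q_measure M) = sets borel"
  using sets.sets_measure_of_eq[of borel] by (simp add: Q_measure_def)

lemma emeasure_Q_measure_greaterThan:
  assumes M: "orlicz_function M" "twice_continuously_differentiable M" "right_deriv M 0 = 0"
    and "0 < x"
  shows "emeasure (Q_measure M) {x<..} = ennreal (1 / x * right_deriv M (1 / x) - M (1 / x))"
proof -
  have [measurable]: "(\<lambda>y. indicator {0..} y * second_deriv M y) \<in> borel_measurable borel"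
    using borel_measurable_continuous_on_indicator[OF _ continuous_on_second_deriv[OF M(2)]] by simp
  have nonneg: "0 \<le> second_deriv M t" if "0 \<le> t" for t
    using second_deriv_nonneg[OF M] that by simp
  have "emeasure (Q_measure M) {x<..} =
    (\<integral>\<^sup>+y\<in>{0..}. ennreal y * indicator {x<..} (1 / y) \<partial>stieltjes (right_deriv M))"
    by (rule emeasure_Q_measure) simp
  also have "stieltjes (right_deriv M) =
    density lborel (\<lambda>y. ennreal (indicator {0..} y * second_deriv M y))"
    by (rule stieltjes_eq_density[OF right_deriv_mono_on[OF M] has_second_deriv[OF M(2)]
          continuous_on_second_deriv[OF M(2)]])
  also have "(\<integral>\<^sup>+y\<in>{0..}. ennreal y * indicator {x<..} (1 / y)
      \<partial>density lborel (\<lambda>y. ennreal (indicator {0..} y * second_deriv M y))) =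
    (\<integral>\<^sup>+y. ennreal (indicator {0..} y * second_deriv M y) *
      (ennreal y * indicator {x<..} (1 / y) * indicator {0..} y) \<partial>lborel)"
    by (rule nn_integral_density) auto
  also have "\<dots> = (\<integral>\<^sup>+y\<in>{0..1 / x}. ennreal (y * second_deriv M y) \<partial>lborel)"
  proof (rule nn_integral_cong_AE)
    \<comment> \<open>Two null points are removed: at \<open>y = 0\<close> the convention
      \<open>1 / 0 = 0\<close> breaks the equivalence below, and at \<open>y = 1 / x\<close> the
      strict and weak inequalities differ.\<close>
    show "AE y in lborel. ennreal (indicator {0..} y * second_deriv M y) *
      (ennreal y * indicator {x<..} (1 / y) * indicator {0..} y) =
      ennreal (y * second_deriv M y) * indicator {0..1 / x} y"
      using AE_lborel_singleton[of 0] AE_lborel_singleton[of "1 / x"]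
    proof eventually_elim
      case (elim y)
      then have "x < 1 / y \<longleftrightarrow> y \<le> 1 / x" if "0 \<le> y"
        using that \<open>0 < x\<close> by (auto simp: field_simps)
      then show ?case
        using elim nonneg[of y]
        by (auto simp: ennreal_mult' mult.commute split: split_indicator)
    qed
  qed
  also have "\<dots> = ennreal ((1 / x * right_deriv M (1 / x) - M (1 / x)) - (0 * right_deriv M 0 - M 0))"
  proof (rule nn_integral_FTC_within)
    show "continuous_on {0..1 / x} (\<lambda>y. y * second_deriv M y)"
      by (intro continuous_intros continuous_on_subset[OF continuous_on_second_deriv[OF M(2)]]) auto
    show "((\<lambda>t. t * right_deriv M t - M t) has_vector_derivative y * second_deriv M y)
      (at y within {0..1 / x})" if "y \<in> {0..1 / x}" for y
      using that by (auto intro: has_vector_derivative_within_subset[OF has_vector_derivative_legendre[OF M(2)]])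
  qed (use \<open>0 < x\<close> nonneg in auto)
  also have "M 0 = 0"
    using M(1) by (simp add: orlicz_function_def)
  finally show ?thesis by simp
qed

section \<open>From Q to the law of the random variable\<close>

lemma tail_distribution_eq_Q_measure:
  assumes "prob_space P" and "X \<in> borel_measurable P"
    and distr: "distr P borel X = scale_measure (1 / emeasure (Q_measure M) {0..}) (Q_measure M)"
    and fin: "(\<integral>\<^sup>+y\<in>{0..}. ennreal y \<partial>stieltjes (right_deriv M)) < \<infinity>"
  shows "tail_distribution P X x = measure (Q_measure M) {x<..} / measure (Q_measure M) {0..}"
proof -
  interpret D: prob_space "distr P borel X"
    using assms(1,2) by (rule prob_space.prob_space_distr)
  have "emeasure (Q_measure M) {0..} \<le> (\<integral>\<^sup>+y\<in>{0..}. ennreal y \<partial>stieltjes (right_deriv M))"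
    by (subst emeasure_Q_measure) (auto intro!: nn_integral_mono split: split_indicator)
  then have "emeasure (Q_measure M) {0..} < \<top>"
    using fin unfolding infinity_ennreal_def by (rule le_less_trans)
  then have inv: "enn2real (inverse (emeasure (Q_measure M) {0..})) =
      inverse (enn2real (emeasure (Q_measure M) {0..}))"
  proof (cases "emeasure (Q_measure M) {0..}")
    case (real r)
    then show ?thesis
      \<comment> \<open>For \<open>r = 0\<close> both sides are 0 by convention: the extended
        inverse is infinite and \<open>enn2real\<close> sends it to 0, while the real inverse of 0
        is 0.\<close>
      by (cases "r = 0") (simp_all add: inverse_ennreal)
  qed simp
  have "tail_distribution P X x = measure (distr P borel X) {x<..}"
    using D.prob_compl[of "{..x}"]
    by (simp add: tail_distribution_def cdf_def Compl_eq_Diff_UNIV[symmetric])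
  also have "\<dots> = enn2real (1 / emeasure (Q_measure M) {0..} * emeasure (Q_measure M) {x<..})"
    unfolding measure_def distr emeasure_scale_measure ..
  also have "\<dots> = measure (Q_measure M) {x<..} / measure (Q_measure M) {0..}"
    by (simp add: measure_def enn2real_mult divide_ennreal_def inv divide_inverse)
  finally show ?thesis .
qed

section \<open>The two integral representations\<close>

text \<open>The law of \<open>X\<close> is Q divided by its total mass, so this mass divides each
  integral that represents the tail of \<open>X\<close>. Integrability is asserted separately
  because \<open>LBINT\<close> of a non-integrable function defaults to 0.\<close>

theorem corollary3p2:
  fixes M :: "real \<Rightarrow> real" and P :: "'a measure" and X :: "'a \<Rightarrow> real"
  assumes "orlicz_function M"
    and "twice_continuously_differentiable M"
    and "(\<integral>\<^sup>+y\<in>{0..}. ennreal y \<partial>stieltjes (right_deriv M)) < \<infinity>"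
    and "right_deriv M 0 = 0"
    and "prob_space P"
    and "X \<in> borel_measurable P"
    and "distr P borel X = scale_measure (1 / emeasure (Q_measure M) {0..}) (Q_measure M)"
  shows "\<forall>x>0.
      interval_lebesgue_integrable lborel 0 (ereal (1 / x)) (\<lambda>y. y * second_deriv M y) \<and>
      tail_distribution P X x =
        (LBINT y=0..ereal (1 / x). y * second_deriv M y) / measure (Q_measure M) {0..} \<and>
      (LBINT y=0..ereal (1 / x). y * second_deriv M y) =
        1 / x * right_deriv M (1 / x) - M (1 / x) \<and>
      interval_lebesgue_integrable lborel (ereal x) \<infinity> (\<lambda>y. 1 / y ^ 3 * second_deriv M (1 / y)) \<and>
      tail_distribution P X x =
        (LBINT y=ereal x..\<infinity>. 1 / y ^ 3 * second_deriv M (1 / y)) / measure (Q_measure M) {0..}"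
proof (intro allI impI)
  fix x :: real assume x: "0 < x"
  note M = assms(1,2,4)
  define H where "H t = t * right_deriv M t - M t" for t
  have H_deriv: "(H has_vector_derivative t * second_deriv M t) (at t within {0..})" if "0 \<le> t" for t
    unfolding H_def using has_vector_derivative_legendre[OF M(2) that] .
  have contH: "continuous_on {0..} H"
    using H_deriv by (auto simp: continuous_on_eq_continuous_within intro: has_vector_derivative_continuous)
  have nonneg: "0 \<le> second_deriv M t" if "0 \<le> t" for t
    using second_deriv_nonneg[OF M that] .
  have H0: "H 0 = 0"
    using M(1) by (simp add: H_def orlicz_function_def)
  have cont: "continuous_on {0..1 / x} (\<lambda>y. y * second_deriv M y)"
    by (intro continuous_intros continuous_on_subset[OF continuous_on_second_deriv[OF M(2)]]) auto
  have integrable: "interval_lebesgue_integrable lborel 0 (ereal (1 / x)) (\<lambda>y. y * second_deriv M y)"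
    using interval_integrable_continuous_on[OF _ cont] x by (simp add: zero_ereal_def)
  have "(LBINT y=ereal 0..ereal (1 / x). y * second_deriv M y) = H (1 / x) - H 0"
    using x cont
    by (intro interval_integral_FTC_finite)
       (auto intro!: has_vector_derivative_within_subset[OF H_deriv])
  then have integral: "(LBINT y=0..ereal (1 / x). y * second_deriv M y) = H (1 / x)"
    by (simp add: H0 zero_ereal_def)
  have "0 \<le> (LBINT y=0..ereal (1 / x). y * second_deriv M y)"
    using x nonneg
    by (auto simp: interval_lebesgue_integral_def set_lebesgue_integral_def einterval_iff
        intro!: integral_nonneg split: split_indicator)
  \<comment> \<open>The tail of Q is known as \<open>ennreal (H (1 / x))\<close>, and
    \<open>ennreal\<close> truncates negative numbers to 0. Nonnegativity allows the real value to
    be recovered.\<close>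
  then have H_nonneg: "0 \<le> H (1 / x)"
    using integral by simp
  have tail: "tail_distribution P X x = H (1 / x) / measure (Q_measure M) {0..}"
    using tail_distribution_eq_Q_measure[OF assms(5-7) assms(3), of x]
      emeasure_Q_measure_greaterThan[OF M x] H_nonneg
    by (simp add: H_def measure_def)

  text \<open>The second representation comes from the antiderivative \<open>-H (1 / y)\<close>, which vanishes at
    infinity since \<open>H\<close> is right-continuous at \<open>0\<close>.\<close>
  have deriv_inv: "((\<lambda>y. - H (1 / y)) has_real_derivative 1 / y ^ 3 * second_deriv M (1 / y)) (at y)"
    if "0 < y" for y
  proof -
    have "(H has_real_derivative 1 / y * second_deriv M (1 / y)) (at (1 / y))"
      using H_deriv[of "1 / y"] that at_within_interior[of "1 / y" "{0..}"]
      by (simp add: has_real_derivative_iff_has_vector_derivative)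
    \<comment> \<open>The chain rule contributes -1/y^2, which with the factor 1/y makes the cube;
      the minus sign is removed by passing to the negative of H(1/y).\<close>
    then have "((\<lambda>y. H (1 / y)) has_real_derivative
        1 / y * second_deriv M (1 / y) * (- 1 / y ^ 2)) (at y)"
      by (rule DERIV_chain2)
         (use that in \<open>auto intro!: derivative_eq_intros simp: power2_eq_square\<close>)
    from DERIV_minus[OF this] show ?thesis
      by (simp add: power2_eq_square power3_eq_cube mult.assoc)
  qed
  have lim_x: "(((\<lambda>y. - H (1 / y)) \<circ> real_of_ereal) \<longlongrightarrow> - H (1 / x)) (at_right (ereal x))"
    using DERIV_isCont[OF deriv_inv[OF x]]
    by (auto simp: ereal_tendsto_simps isCont_def intro: tendsto_within_subset)
  \<comment> \<open>As y tends to infinity, 1/y approaches 0 inside \<open>{0..}\<close> without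
    reaching it, so the one-sided continuity of \<open>H\<close> at 0 suffices.\<close>
  have "filterlim (\<lambda>y::real. 1 / y) (at 0 within {0..}) at_top"
    unfolding filterlim_at
  proof
    show "((\<lambda>y::real. 1 / y) \<longlongrightarrow> 0) at_top"
      by (rule tendsto_divide_0[OF tendsto_const]) (simp add: filterlim_at_top_imp_at_infinity filterlim_ident)
    show "\<forall>\<^sub>F y::real in at_top. 1 / y \<in> {0..} \<and> 1 / y \<noteq> 0"
      using eventually_gt_at_top[of 0] by eventually_elim auto
  qed
  moreover have "(H \<longlongrightarrow> 0) (at 0 within {0..})"
    using contH[unfolded continuous_on_def, rule_format, of 0] H0 by simp
  ultimately have "((\<lambda>y. H (1 / y)) \<longlongrightarrow> 0) at_top"
    by (rule filterlim_compose[rotated])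
  then have lim_top: "(((\<lambda>y. - H (1 / y)) \<circ> real_of_ereal) \<longlongrightarrow> 0) (at_left \<infinity>)"
    using tendsto_minus by (force simp: ereal_tendsto_simps)
  have cont_inv: "isCont (\<lambda>y. 1 / y ^ 3 * second_deriv M (1 / y)) y" if "0 < y" for y
    using that isCont_o2[of y "\<lambda>y. 1 / y" "second_deriv M"] isCont_second_deriv[OF M(2), of "1 / y"]
    by (intro continuous_intros) auto
  \<comment> \<open>For a nonnegative integrand, finite limits of the antiderivative at both ends
    yield integrability on the unbounded interval together with the value of the integral.\<close>
  have FTC: "set_integrable lborel (einterval (ereal x) \<infinity>) (\<lambda>y. 1 / y ^ 3 * second_deriv M (1 / y))"
    "(LBINT y=ereal x..\<infinity>. 1 / y ^ 3 * second_deriv M (1 / y)) = 0 - (- H (1 / x))"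
    using x nonneg
    by (intro interval_integral_FTC_nonneg[OF _ deriv_inv cont_inv _ lim_x lim_top]; auto)+
  from FTC(1) have "interval_lebesgue_integrable lborel (ereal x) \<infinity> (\<lambda>y. 1 / y ^ 3 * second_deriv M (1 / y))"
    by (simp add: interval_lebesgue_integrable_def)
  then show "interval_lebesgue_integrable lborel 0 (ereal (1 / x)) (\<lambda>y. y * second_deriv M y) \<and>
      tail_distribution P X x =
        (LBINT y=0..ereal (1 / x). y * second_deriv M y) / measure (Q_measure M) {0..} \<and>
      (LBINT y=0..ereal (1 / x). y * second_deriv M y) =
        1 / x * right_deriv M (1 / x) - M (1 / x) \<and>
      interval_lebesgue_integrable lborel (ereal x) \<infinity> (\<lambda>y. 1 / y ^ 3 * second_deriv M (1 / y)) \<and>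
      tail_distribution P X x =
        (LBINT y=ereal x..\<infinity>. 1 / y ^ 3 * second_deriv M (1 / y)) / measure (Q_measure M) {0..}"
    using integrable integral FTC(2) tail by (simp add: H_def)
qed

end
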